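(* Let $p\ge 1$ be an integer. There is a constant $C>0$ depending only on $p$ such that the following holds. Let $L>0$, let $\mathcal X\subseteq\mathbb R^d$ be closed, convex and bounded with diameter $D>0$, let $F:\mathbb R^d\to\mathbb R^d$ be $(p-1)^{\text{th}}$-order $L$-smooth and monotone, let $x_0\in\mathcal X$ and $\epsilon\in(0,1)$. Then there is an integer $T\ge 1$, depending only on $p,L,D,\epsilon$, with $$T\le C\,\max\Big\{1,\Big(\frac{LD^{p+1}}{\epsilon}\Big)^{\frac{2}{p+1}}\Big\},$$ such that every output $\hat x$ of $\mathsf{Perseus}(p,x_0,L,T,0)$ satisfies $\textsc{gap}(\hat x)\le\epsilon$, where $\textsc{gap}(\hat x)=\sup_{x\in\mathcal X}\langle F(x),\hat x-x\rangle$. The total number of calls of the subproblem solver is equal to $T$ (or smaller if the method stops early at a solution).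
   Context: Norms are Euclidean. The diameter is $D=\max_{x,x'\in\mathcal X}\|x-x'\|$. $F$ is $(p-1)^{\text{th}}$-order $L$-smooth if it is $(p-1)$ times continuously differentiable and $\|\nabla^{(p-1)}F(x)-\nabla^{(p-1)}F(x')\|_{\mathrm{op}}\le L\|x-x'\|$ for all $x,x'\in\mathbb R^d$ (operator norm of multilinear maps; $\nabla^{(0)}F=F$). $F$ is monotone if $\langle F(x)-F(x'),x-x'\rangle\ge 0$ for all $x,x'\in\mathbb R^d$. For $v\in\mathcal X$ define $$F_v(x)=\sum_{j=0}^{p-1}\tfrac1{j!}\nabla^{(j)}F(v)[x-v]^j+\tfrac{5L}{(p-1)!}\|x-v\|^{p-1}(x-v)$$ (for $p=1$: $F_v(x)=F(v)+5L(x-v)$). Method $\mathsf{Perseus}(p,x_0,L,T,\mathsf{opt})$ with $\mathsf{opt}=0$. Set $s_0=0$. For $k=0,1,\dots,T-1$: (1) if $x_k$ is a solution of the VI, i.e. $\langle F(x_k),x-x_k\rangle\ge0$ for all $x\in\mathcal X$, stop and return $x_k$; (2) $v_{k+1}=\operatorname{argmax}_{v\in\mathcal X}\{\langle s_k,v-x_0\rangle-\frac12\|v-x_0\|^2\}$; (3) (one call of the subproblem solver) take any $x_{k+1}\in\mathcal X$ with $\sup_{x\in\mathcal X}\langle F_{v_{k+1}}(x_{k+1}),x_{k+1}-x\rangle\le\frac{L}{p!}\|x_{k+1}-v_{k+1}\|^{p+1}$; (4) take any $\lambda_{k+1}>0$ with $\frac1{20p-8}\le\frac{\lambda_{k+1}L\|x_{k+1}-v_{k+1}\|^{p-1}}{p!}\le\frac1{10p+2}$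 (with the convention $t^0=1$; if $p\ge2$ and $x_{k+1}=v_{k+1}$, then $x_{k+1}$ is a solution of the VI and the method stops and returns it); (5) $s_{k+1}=s_k-\lambda_{k+1}F(x_{k+1})$. If it did not stop early, the output is $\hat x=\frac{1}{\sum_{k=1}^T\lambda_k}\sum_{k=1}^T\lambda_kx_k$. *)

theory Defs
  imports "HOL-Analysis.Analysis"
begin

text \<open>
  The constants of the theorem must not depend on the dimension. A type variable for the
  space would be quantified outside of these constants, so all the spaces of dimension
  \<open>d\<close> are realised inside a single inner product space, the finitely supported real
  sequences, as the subspaces \<open>Rn d\<close>. Norm, inner product, topology and Frechet
  derivatives on them are those of the library.
\<close>

typedef fseq = "{x :: nat \<Rightarrow> real. finite {i. x i \<noteq> 0}}"
  morphisms coord Abs_fseq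
  by (rule exI[of _ "\<lambda>_. 0"]) simp

setup_lifting type_definition_fseq

lemma finite_coord: "finite {i. coord x i \<noteq> 0}"
  using coord[of x] by simp

lemma fseq_eqI: "(\<And>i. coord x i = coord y i) \<Longrightarrow> x = y"
  by (simp add: coord_inject[symmetric] fun_eq_iff)

instantiation fseq :: real_vector
begin

lift_definition zero_fseq :: fseq is "\<lambda>_. 0" by simp

lift_definition plus_fseq :: "fseq \<Rightarrow> fseq \<Rightarrow> fseq" is "\<lambda>x y i. x i + y i"
  subgoal for x y by (rule finite_subset[of _ "{i. x i \<noteq> 0} \<union> {i. y i \<noteq> 0}"]) auto
  done

lift_definition minus_fseq :: "fseq \<Rightarrow> fseq \<Rightarrow> fseq" is "\<lambda>x y i. x i - y i"
  subgoal for x y by (rule finite_subset[of _ "{i. x i \<noteq> 0} \<union> {i. y i \<noteq> 0}"]) auto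
  done

lift_definition uminus_fseq :: "fseq \<Rightarrow> fseq" is "\<lambda>x i. - x i" by simp

lift_definition scaleR_fseq :: "real \<Rightarrow> fseq \<Rightarrow> fseq" is "\<lambda>c x i. c * x i"
  subgoal for c x by (rule finite_subset[of _ "{i. x i \<noteq> 0}"]) auto
  done

instance
  by standard (transfer; auto simp: algebra_simps)+

end

lemma coord_simps [simp]:
  "coord 0 i = 0" "coord (x + y) i = coord x i + coord y i"
  "coord (x - y) i = coord x i - coord y i" "coord (- x) i = - coord x i"
  "coord (c *\<^sub>R x) i = c * coord x i"
  by (transfer; simp)+

instantiation fseq :: real_inner
begin

definition inner_fseq :: "fseq \<Rightarrow> fseq \<Rightarrow> real" where
  "inner_fseq x y = (\<Sum>i | coord x i \<noteq> 0. coord x i * coord y i)"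

definition norm_fseq :: "fseq \<Rightarrow> real" where
  "norm_fseq x = sqrt (inner x x)"

definition dist_fseq :: "fseq \<Rightarrow> fseq \<Rightarrow> real" where
  "dist_fseq x y = norm (x - y)"

definition sgn_fseq :: "fseq \<Rightarrow> fseq" where
  "sgn_fseq x = x /\<^sub>R norm x"

definition uniformity_fseq :: "(fseq \<times> fseq) filter" where
  "uniformity_fseq = (INF e\<in>{0<..}. principal {(x, y). dist x y < e})"

definition open_fseq :: "fseq set \<Rightarrow> bool" where
  "open_fseq S = (\<forall>x\<in>S. \<forall>\<^sub>F (x', y) in uniformity. x' = x \<longrightarrow> y \<in> S)"

lemma inner_fseq_superset:
  assumes "finite I" "{i. coord x i \<noteq> 0} \<subseteq> I"
  shows "inner x y = (\<Sum>i\<in>I. coord x i * coord y i)"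
  unfolding inner_fseq_def using assms by (intro sum.mono_neutral_left) auto

instance
proof
  fix x y z :: fseq and r :: real
  define I where "I = {i. coord x i \<noteq> 0} \<union> {i. coord y i \<noteq> 0}"
  have fin: "finite I" by (simp add: I_def finite_coord)
  have on_I: "inner u w = (\<Sum>i\<in>I. coord u i * coord w i)"
    if "{i. coord u i \<noteq> 0} \<subseteq> I" for u w
    using inner_fseq_superset[OF fin that] .
  have "inner x y = (\<Sum>i\<in>I. coord x i * coord y i)" by (rule on_I) (auto simp: I_def)
  moreover have "inner y x = (\<Sum>i\<in>I. coord y i * coord x i)"
    by (rule on_I) (auto simp: I_def)
  ultimately show "inner x y = inner y x" by (simp add: mult.commute)
  have "inner (x + y) z = (\<Sum>i\<in>I. coord (x + y) i * coord z i)"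
    by (rule on_I) (auto simp: I_def)
  moreover have "inner x z = (\<Sum>i\<in>I. coord x i * coord z i)"
    by (rule on_I) (auto simp: I_def)
  moreover have "inner y z = (\<Sum>i\<in>I. coord y i * coord z i)"
    by (rule on_I) (auto simp: I_def)
  ultimately show "inner (x + y) z = inner x z + inner y z"
    by (simp add: algebra_simps sum.distrib)
  have "inner (r *\<^sub>R x) y = (\<Sum>i\<in>I. coord (r *\<^sub>R x) i * coord y i)"
    by (rule on_I) (auto simp: I_def)
  moreover have "inner x y = (\<Sum>i\<in>I. coord x i * coord y i)"
    by (rule on_I) (auto simp: I_def)
  ultimately show "inner (r *\<^sub>R x) y = r * inner x y"
    by (simp add: sum_distrib_left mult.assoc)
  show "0 \<le> inner x x" by (simp add: inner_fseq_def sum_nonneg)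
  show "inner x x = 0 \<longleftrightarrow> x = 0"
    using finite_coord[of x] fseq_eqI[of x 0]
    by (auto simp: inner_fseq_def sum_nonneg_eq_0_iff)
qed (simp_all add: norm_fseq_def dist_fseq_def sgn_fseq_def uniformity_fseq_def open_fseq_def)

end

definition Rn :: "nat \<Rightarrow> fseq set" where
  "Rn d = {x. \<forall>i\<ge>d. coord x i = 0}"

lemma subspace_Rn: "subspace (Rn d)"
  by (auto simp: Rn_def subspace_def)

lemma inner_Rn: "x \<in> Rn d \<Longrightarrow> inner x y = (\<Sum>i<d. coord x i * coord y i)"
  by (rule inner_fseq_superset) (auto simp: Rn_def not_le[symmetric])

lemma bij_betw_coord_Rn: "bij_betw coord (Rn d) {x. \<forall>i\<ge>d. x i = 0}"
proof (rule bij_betwI')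
  fix x :: "nat \<Rightarrow> real"
  assume x: "x \<in> {x. \<forall>i\<ge>d. x i = 0}"
  have "{i. x i \<noteq> 0} \<subseteq> {..<d}" using x by (auto simp: not_le[symmetric])
  then have "coord (Abs_fseq x) = x"
    by (intro Abs_fseq_inverse) (auto intro: finite_subset)
  with x show "\<exists>y\<in>Rn d. x = coord y"
    by (intro bexI[of _ "Abs_fseq x"]) (auto simp: Rn_def)
qed (auto simp: coord_inject Rn_def)

text \<open>
  In what follows \<open>E\<close> is the whole space (a finite-dimensional subspace of the type);
  maps are only considered on \<open>E\<close>. \<open>nabla E F [h\<^sub>1, ..., h\<^sub>j] x\<close> is the \<open>j\<close>-th
  derivative of \<open>F\<close> at \<open>x\<close>, a multilinear map, applied to \<open>h\<^sub>1, ..., h\<^sub>j\<close>. Since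
  \<open>E\<close> is a subspace, the derivative at \<open>x\<close> within \<open>E\<close> is uniquely determined on \<open>E\<close>.
\<close>

primrec nabla :: "'a::real_inner set \<Rightarrow> ('a \<Rightarrow> 'a) \<Rightarrow> 'a list \<Rightarrow> 'a \<Rightarrow> 'a" where
  "nabla E F [] = F"
| "nabla E F (h # hs) = (\<lambda>x. frechet_derivative (nabla E F hs) (at x within E) h)"

text \<open>
  As \<open>E\<close> is finite-dimensional, a map into the multilinear maps on \<open>E\<close> is (Frechet)
  differentiable, respectively continuous, iff its evaluation at every tuple of
  vectors is.
\<close>

definition times_cont_diff_on :: "nat \<Rightarrow> 'a::real_inner set \<Rightarrow> ('a \<Rightarrow> 'a) \<Rightarrow> bool" where
  "times_cont_diff_on k E F \<longleftrightarrow>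
     (\<forall>hs\<in>lists E. length hs < k \<longrightarrow> nabla E F hs differentiable_on E) \<and>
     (\<forall>hs\<in>lists E. length hs \<le> k \<longrightarrow> continuous_on E (nabla E F hs))"

text \<open>
  Operator norm of a \<open>k\<close>-linear map on \<open>E\<close>, for \<open>k = 1\<close> the quotient of \<^const>\<open>onorm\<close>;
  extended-real-valued, so that the supremum is meaningful without knowing that it is finite.
\<close>

definition multi_onorm :: "nat \<Rightarrow> 'a::real_inner set \<Rightarrow> ('a list \<Rightarrow> 'a) \<Rightarrow> ereal" where
  "multi_onorm k E m =
     (SUP hs\<in>{hs \<in> lists E. length hs = k}. ereal (norm (m hs) / prod_list (map norm hs)))"

definition order_smooth :: "nat \<Rightarrow> real \<Rightarrow> 'a::real_inner set \<Rightarrow> ('a \<Rightarrow> 'a) \<Rightarrow> bool" where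
  "order_smooth k L E F \<longleftrightarrow> times_cont_diff_on k E F \<and>
     (\<forall>x\<in>E. \<forall>x'\<in>E.
        multi_onorm k E (\<lambda>hs. nabla E F hs x - nabla E F hs x') \<le> ereal (L * norm (x - x')))"

definition monotone_operator_on :: "'a::real_inner set \<Rightarrow> ('a \<Rightarrow> 'a) \<Rightarrow> bool" where
  "monotone_operator_on E F \<longleftrightarrow> (\<forall>x\<in>E. \<forall>x'\<in>E. (F x - F x') \<bullet> (x - x') \<ge> 0)"

definition vi_solution :: "('a::real_inner \<Rightarrow> 'a) \<Rightarrow> 'a set \<Rightarrow> 'a \<Rightarrow> bool" where
  "vi_solution F X z \<longleftrightarrow> z \<in> X \<and> (\<forall>x\<in>X. F z \<bullet> (x - z) \<ge> 0)"

text \<open>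
  The real suprema here and in the subproblem are over bounded sets: \<open>X\<close> is compact and nonempty,
  and \<open>F\<close> is continuous on it.
\<close>

definition gap :: "('a::real_inner \<Rightarrow> 'a) \<Rightarrow> 'a set \<Rightarrow> 'a \<Rightarrow> real" where
  "gap F X z = (SUP x\<in>X. F x \<bullet> (z - x))"

definition tensor_model ::
    "'a::real_inner set \<Rightarrow> nat \<Rightarrow> real \<Rightarrow> ('a \<Rightarrow> 'a) \<Rightarrow> 'a \<Rightarrow> 'a \<Rightarrow> 'a" where
  "tensor_model E p L F v x =
     (\<Sum>j = 0..p - 1. (1 / fact j) *\<^sub>R nabla E F (replicate j (x - v)) v)
     + (5 * L / fact (p - 1) * norm (x - v) ^ (p - 1)) *\<^sub>R (x - v)"

definition dual_step :: "'a::real_inner set \<Rightarrow> 'a \<Rightarrow> 'a \<Rightarrow> 'a \<Rightarrow> bool" where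
  "dual_step X x0 s v \<longleftrightarrow>
     is_arg_max (\<lambda>v. s \<bullet> (v - x0) - 1/2 * (norm (v - x0))\<^sup>2) (\<lambda>v. v \<in> X) v"

definition subproblem_solution ::
    "'a::real_inner set \<Rightarrow> nat \<Rightarrow> real \<Rightarrow> ('a \<Rightarrow> 'a) \<Rightarrow> 'a set \<Rightarrow> 'a \<Rightarrow> 'a \<Rightarrow> bool" where
  "subproblem_solution E p L F X v y \<longleftrightarrow> y \<in> X \<and>
     (SUP x\<in>X. tensor_model E p L F v y \<bullet> (y - x)) \<le> L / fact p * norm (y - v) ^ (p + 1)"

definition admissible_weight :: "nat \<Rightarrow> real \<Rightarrow> 'a::real_inner \<Rightarrow> 'a \<Rightarrow> real \<Rightarrow> bool" where
  "admissible_weight p L v y w \<longleftrightarrow> w > 0 \<and>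
     1 / (20 * real p - 8) \<le> w * L * norm (y - v) ^ (p - 1) / fact p \<and>
     w * L * norm (y - v) ^ (p - 1) / fact p \<le> 1 / (10 * real p + 2)"

text \<open>
  \<open>perseus_run E p L F X x0 k n ws x s\<close>: some execution has completed \<open>k\<close> iterations without
  stopping, with \<open>n\<close> calls of the subproblem solver, and now \<open>x = x\<^sub>k\<close>, \<open>s = s\<^sub>k\<close> and
  \<open>ws = [(\<lambda>\<^sub>1, x\<^sub>1), ..., (\<lambda>\<^sub>k, x\<^sub>k)]\<close>.
\<close>

inductive perseus_run ::
    "'a::real_inner set \<Rightarrow> nat \<Rightarrow> real \<Rightarrow> ('a \<Rightarrow> 'a) \<Rightarrow> 'a set \<Rightarrow> 'a \<Rightarrow>
     nat \<Rightarrow> nat \<Rightarrow> (real \<times> 'a) list \<Rightarrow> 'a \<Rightarrow> 'a \<Rightarrow> bool"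
  for E p L F X x0
where
  start: "perseus_run E p L F X x0 0 0 [] x0 0"
| iteration:
    "perseus_run E p L F X x0 k n ws x s \<Longrightarrow>
     \<not> vi_solution F X x \<Longrightarrow>
     dual_step X x0 s v \<Longrightarrow>
     subproblem_solution E p L F X v y \<Longrightarrow>
     \<not> (p \<ge> 2 \<and> y = v) \<Longrightarrow>
     admissible_weight p L v y w \<Longrightarrow>
     perseus_run E p L F X x0 (Suc k) (Suc n) (ws @ [(w, y)]) y (s - w *\<^sub>R F y)"

text \<open>
  \<open>perseus_output E p L F X x0 T early z n\<close>: some execution with iteration budget \<open>T\<close> returns
  \<open>z\<close> after \<open>n\<close> calls of the subproblem solver; \<open>early\<close> tells whether it left the loop
  through one of the two stopping tests.
\<close>

inductive perseus_output ::
    "'a::real_inner set \<Rightarrow> nat \<Rightarrow> real \<Rightarrow> ('a \<Rightarrow> 'a) \<Rightarrow> 'a set \<Rightarrow> 'a \<Rightarrow> nat \<Rightarrow>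
     bool \<Rightarrow> 'a \<Rightarrow> nat \<Rightarrow> bool"
  for E p L F X x0 T
where
  stop_at_iterate:
    "perseus_run E p L F X x0 k n ws x s \<Longrightarrow> k < T \<Longrightarrow>
     vi_solution F X x \<Longrightarrow>
     perseus_output E p L F X x0 T True x n"
| stop_after_subproblem:
    "perseus_run E p L F X x0 k n ws x s \<Longrightarrow> k < T \<Longrightarrow>
     \<not> vi_solution F X x \<Longrightarrow>
     dual_step X x0 s v \<Longrightarrow>
     subproblem_solution E p L F X v y \<Longrightarrow>
     p \<ge> 2 \<Longrightarrow> y = v \<Longrightarrow>
     perseus_output E p L F X x0 T True y (Suc n)"
| average:
    "perseus_run E p L F X x0 T n ws x s \<Longrightarrow>
     perseus_output E p L F X x0 T False
       ((1 / (\<Sum>(w, y)\<leftarrow>ws. w)) *\<^sub>R (\<Sum>(w, y)\<leftarrow>ws. w *\<^sub>R y)) n"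

end

theory Submission
  imports Defs
begin

text \<open>
  Write \<open>r\<^sub>i = \<parallel>x\<^sub>i - v\<^sub>i\<parallel>\<close>. Every point \<open>z\<close> of \<open>X\<close> satisfies the regret bound
  \<open>\<Sum> \<lambda>\<^sub>i \<langle>F(x\<^sub>i), x\<^sub>i - z\<rangle> + 1/8 \<Sum> r\<^sub>i\<^sup>2 \<le> 1/2 \<parallel>z - x\<^sub>0\<parallel>\<^sup>2\<close> (\<open>perseus_run_potential\<close>). It is proved
  by induction on the number of iterations. The dual step maximises a 1-strongly concave function, so
  that moving from \<open>v\<^sub>i\<close> to \<open>z\<close> costs \<open>1/2 \<parallel>z - v\<^sub>i\<parallel>\<^sup>2\<close> (\<open>dual_step_strong\<close>), and
  \<open>iteration_decrease\<close> shows that this cost pays for \<open>\<lambda>\<^sub>i \<langle>F(x\<^sub>i), x\<^sub>i - z\<rangle>\<close> with \<open>r\<^sub>i\<^sup>2/8\<close> to spare: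
  by Taylor's formula the model differs from \<open>F\<close> by its regularisation term up to \<open>L/p! r\<^sub>i\<^sup>p\<close>, and
  the factor 5 of that term and the window for \<open>\<lambda>\<^sub>i\<close> absorb this error together with that of the
  subproblem solver.

  Monotonicity turns the regret at \<open>z\<close>, divided by \<open>\<Lambda> = \<Sum> \<lambda>\<^sub>i\<close>, into an upper bound for the
  contribution of \<open>z\<close> to the gap of the average. The gap at \<open>z\<close> is therefore at most \<open>D\<^sup>2/(2 \<Lambda>)\<close>, and
  it remains to see that \<open>\<Lambda>\<close> is large. The weights satisfy \<open>\<lambda>\<^sub>i \<ge> c / r\<^sub>i\<^sup>p\<^sup>-\<^sup>1\<close>, and \<open>\<Sum> r\<^sub>i\<^sup>2 \<le> 4 D\<^sup>2\<close> by the
  regret bound as soon as the regret at \<open>z\<close> is nonnegative; by convexity of \<open>u \<mapsto> u powr (-(p-1)/2)\<close>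
  the sum \<open>\<Lambda>\<close> is then smallest when all the \<open>r\<^sub>i\<^sup>2\<close> equal \<open>4 D\<^sup>2/T\<close>, which makes it at least of order
  \<open>T powr ((p+1)/2) / (L D\<^sup>p\<^sup>-\<^sup>1)\<close>. If the regret at \<open>z\<close> is negative, then so is the contribution of
  \<open>z\<close> to the gap.

  The argument takes place in inner products of finitely many vectors, which is why all the lemmas
  are about a subspace \<open>E\<close> of an arbitrary inner product space; this also keeps the constant
  independent of the dimension.
\<close>

section \<open>Taylor's formula with a Lipschitz highest derivative\<close>

text \<open>
  \<open>G j\<close> stands for the \<open>j\<close>-th derivative of the curve \<open>G 0\<close>. The remainder vanishes at \<open>0\<close>, and its
  derivative is the remainder, one order lower, of \<open>G 1\<close>; so the estimate follows by induction from
  the mean value inequality. The highest derivative \<open>G m\<close> is only Lipschitz at \<open>0\<close>, so the induction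
  starts with that condition and not with a bound on a further derivative.
\<close>

lemma taylor_remainder_line:
  fixes G :: "nat \<Rightarrow> real \<Rightarrow> 'a::real_normed_vector"
  assumes "\<And>j t. j < m \<Longrightarrow> t \<in> {0..1} \<Longrightarrow>
      (G j has_vector_derivative G (Suc j) t) (at t within {0..1})"
    and "\<And>t. t \<in> {0..1} \<Longrightarrow> norm (G m t - G m 0) \<le> M * t"
    and "t \<in> {0..1}"
  shows "norm (G 0 t - (\<Sum>i = 0..m. (t ^ i / fact i) *\<^sub>R G i 0)) \<le> M * t ^ Suc m / fact (Suc m)"
  using assms
proof (induction m arbitrary: G t)
  case 0
  then show ?case by simp
next
  case (Suc m)
  define R where "R = (\<lambda>s. G 0 s - (\<Sum>i = 0..Suc m. (s ^ i / fact i) *\<^sub>R G i 0))"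
  define R' where "R' = (\<lambda>s. G (Suc 0) s - (\<Sum>i = 0..m. (s ^ i / fact i) *\<^sub>R G (Suc i) 0))"
  have R_eq: "R = (\<lambda>s. G 0 s - (G 0 0 + (\<Sum>i = 0..m. (s ^ Suc i / fact (Suc i)) *\<^sub>R G (Suc i) 0)))"
    unfolding R_def by (subst sum.atLeast0_atMost_Suc_shift) simp
  have pow': "((\<lambda>s::real. s ^ Suc i / fact (Suc i)) has_real_derivative s ^ i / fact i)
      (at s within {0..1})" for i s
    by (auto intro!: derivative_eq_intros simp del: power_Suc simp: divide_simps)
  have sum': "((\<lambda>s. \<Sum>i = 0..m. (s ^ Suc i / fact (Suc i)) *\<^sub>R G (Suc i) 0) has_vector_derivative
      (\<Sum>i = 0..m. (s ^ i / fact i) *\<^sub>R G (Suc i) 0)) (at s within {0..1})" for s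
    by (rule has_vector_derivative_sum)
      (use has_vector_derivative_scaleR[OF pow' has_vector_derivative_const] in simp)
  have R_deriv: "(R has_vector_derivative R' s) (at s within {0..1})" if "s \<in> {0..1}" for s
  proof -
    have "((\<lambda>s. G 0 s - (G 0 0 + (\<Sum>i = 0..m. (s ^ Suc i / fact (Suc i)) *\<^sub>R G (Suc i) 0)))
        has_vector_derivative
        G (Suc 0) s - (0 + (\<Sum>i = 0..m. (s ^ i / fact i) *\<^sub>R G (Suc i) 0))) (at s within {0..1})"
      by (intro has_vector_derivative_diff has_vector_derivative_add has_vector_derivative_const
          sum' Suc.prems(1) that) simp
    then show ?thesis
      unfolding R_eq R'_def by simp
  qed
  have bnd: "norm (R' s) \<le> M * s ^ Suc m / fact (Suc m)" if "s \<in> {0..1}" for s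
    unfolding R'_def using that
    by (intro Suc.IH[of "\<lambda>j. G (Suc j)"] Suc.prems) auto
  show ?case
  proof (cases "t = 0")
    case True
    then show ?thesis
      by (subst sum.atLeast0_atMost_Suc_shift) simp
  next
    case False
    then have t: "0 < t" "t \<le> 1" using Suc.prems(3) by auto
    have pd: "((\<lambda>s. M * s ^ Suc (Suc m) / fact (Suc (Suc m))) has_vector_derivative
        M * s ^ Suc m / fact (Suc m)) (at s)" for s :: real
      unfolding has_real_derivative_iff_has_vector_derivative[symmetric]
      by (auto intro!: derivative_eq_intros simp del: power_Suc simp: divide_simps)
    have "norm (R t - R 0) \<le> M * t ^ Suc (Suc m) / fact (Suc (Suc m))
        - M * 0 ^ Suc (Suc m) / fact (Suc (Suc m))"
    proof (rule differentiable_bound_general[OF t(1)])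
      have "continuous_on {0..1} R"
        using R_deriv by (rule continuous_on_vector_derivative)
      then show "continuous_on {0..t} R"
        by (rule continuous_on_subset) (use t in auto)
      show "continuous_on {0..t} (\<lambda>s. M * s ^ Suc (Suc m) / fact (Suc (Suc m)))"
        by (intro continuous_intros) auto
      fix s assume s: "0 < s" "s < t"
      then have "s \<in> interior {0..1}" using t by simp
      then have "at s within {0..1} = at s" by (rule at_within_interior)
      then show "(R has_vector_derivative R' s) (at s)"
        using R_deriv[of s] s t by simp
      show "norm (R' s) \<le> M * s ^ Suc m / fact (Suc m)"
        using s t by (intro bnd) auto
    qed (rule pd)
    moreover have "R 0 = 0" unfolding R_eq by simp
    ultimately show ?thesis by (simp add: R_def)
  qed
qed

text \<open>
  The one-dimensional estimate along the segment from \<open>v\<close> to \<open>x\<close>: all the iterated derivatives are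
  taken in the same direction \<open>x - v\<close>, so that the chain rule gives those of the restriction of
  \<open>F\<close> to the segment.
\<close>

lemma taylor_remainder:
  fixes F :: "'a::real_inner \<Rightarrow> 'a"
  assumes E: "subspace E" and F: "order_smooth m L E F" and v: "v \<in> E" and x: "x \<in> E"
  shows "norm (F x - (\<Sum>j = 0..m. (1 / fact j) *\<^sub>R nabla E F (replicate j (x - v)) v))
    \<le> L / fact (Suc m) * norm (x - v) ^ Suc m"
proof -
  define h where "h = x - v"
  define G where "G = (\<lambda>j t. nabla E F (replicate j h) (v + t *\<^sub>R h))"
  have h: "h \<in> E" unfolding h_def using E v x by (simp add: subspace_diff)
  have line: "v + t *\<^sub>R h \<in> E" for t
    using E v h by (simp add: subspace_add subspace_scale)
  have hs: "replicate j h \<in> lists E" for j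
    using h by (auto simp: in_lists_conv_set)
  have "norm (G 0 1 - (\<Sum>i = 0..m. (1 ^ i / fact i) *\<^sub>R G i 0))
    \<le> (L * norm h ^ Suc m) * 1 ^ Suc m / fact (Suc m)"
  proof (rule taylor_remainder_line)
    fix j :: nat and t :: real assume j: "j < m" and t: "t \<in> {0..1}"
    have "nabla E F (replicate j h) differentiable_on E"
      using F j hs unfolding order_smooth_def times_cont_diff_on_def by auto
    then have "(nabla E F (replicate j h) has_derivative
        frechet_derivative (nabla E F (replicate j h)) (at (v + t *\<^sub>R h) within E))
        (at (v + t *\<^sub>R h) within E)"
      using line by (auto simp: differentiable_on_def frechet_derivative_works)
    then have D: "(nabla E F (replicate j h) has_derivative
        frechet_derivative (nabla E F (replicate j h)) (at (v + t *\<^sub>R h) within E))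
        (at (v + t *\<^sub>R h) within (\<lambda>t. v + t *\<^sub>R h) ` {0..1})"
      by (rule has_derivative_subset) (use line in auto)
    have "((\<lambda>t. v + t *\<^sub>R h) has_vector_derivative h) (at t within {0..1})"
      by (auto intro!: derivative_eq_intros)
    from vector_derivative_diff_chain_within[OF this D]
    show "(G j has_vector_derivative G (Suc j) t) (at t within {0..1})"
      by (simp add: G_def o_def)
  next
    fix t :: real assume t: "t \<in> {0..1}"
    let ?N = "norm (nabla E F (replicate m h) (v + t *\<^sub>R h) - nabla E F (replicate m h) v)"
    have "ereal (?N / prod_list (map norm (replicate m h))) \<le>
        multi_onorm m E (\<lambda>hs. nabla E F hs (v + t *\<^sub>R h) - nabla E F hs v)"
      unfolding multi_onorm_def using hs[of m] by (intro SUP_upper2[of "replicate m h"]) auto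
    also have "\<dots> \<le> ereal (L * norm (v + t *\<^sub>R h - v))"
      using F line v unfolding order_smooth_def by blast
    finally have le: "?N / norm h ^ m \<le> L * (t * norm h)"
      using t by simp
    show "norm (G m t - G m 0) \<le> L * norm h ^ Suc m * t"
    proof (cases "h = 0")
      case False
      then have "?N \<le> L * (t * norm h) * norm h ^ m"
        using le by (simp add: pos_divide_le_eq)
      then show ?thesis by (simp add: G_def mult_ac)
    qed (simp add: G_def)
  qed simp
  then show ?thesis
    by (simp add: G_def h_def)
qed

section \<open>One iteration\<close>

lemma tensor_model_error:
  fixes F :: "'a::real_inner \<Rightarrow> 'a"
  assumes "p \<ge> 1" "subspace E" "order_smooth (p - 1) L E F" "v \<in> E" "y \<in> E"
  shows "norm (F y + (5 * L / fact (p - 1) * norm (y - v) ^ (p - 1)) *\<^sub>R (y - v) - tensor_model E p L F v y)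
    \<le> L / fact p * norm (y - v) ^ p"
  using taylor_remainder[OF assms(2-5)] assms(1) by (simp add: tensor_model_def)

text \<open>Boundedness of \<open>X\<close> makes the real supremum of the accuracy condition an upper bound.\<close>

lemma subproblem_solutionD:
  fixes F :: "'a::real_inner \<Rightarrow> 'a"
  assumes "subproblem_solution E p L F X v y" and X: "bounded X" and z: "z \<in> X"
  shows "tensor_model E p L F v y \<bullet> (y - z) \<le> L / fact p * norm (y - v) ^ (p + 1)"
proof -
  let ?g = "tensor_model E p L F v y"
  obtain B where B: "\<And>x. x \<in> X \<Longrightarrow> norm x \<le> B" using X by (auto simp: bounded_iff)
  have "?g \<bullet> (y - x) \<le> norm ?g * (norm y + B)" if "x \<in> X" for x
  proof -
    have "?g \<bullet> (y - x) \<le> norm ?g * norm (y - x)" by (rule norm_cauchy_schwarz)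
    also have "\<dots> \<le> norm ?g * (norm y + B)"
      using norm_triangle_ineq4[of y x] B[OF that] by (intro mult_left_mono) auto
    finally show ?thesis .
  qed
  then have "bdd_above ((\<lambda>x. ?g \<bullet> (y - x)) ` X)" by (auto intro!: bdd_aboveI)
  then have "?g \<bullet> (y - z) \<le> (SUP x\<in>X. ?g \<bullet> (y - x))" using z by (rule cSUP_upper2) simp
  then show ?thesis using assms(1) by (simp add: subproblem_solution_def)
qed

text \<open>
  This is what the second stopping test rests on: the model is exact at its centre, hence a
  subproblem solution that coincides with its centre solves the variational inequality.
\<close>

lemma tensor_model_at_center:
  fixes F :: "'a::real_inner \<Rightarrow> 'a"
  assumes "p \<ge> 1" "subspace E" "order_smooth (p - 1) L E F" "v \<in> E"
  shows "tensor_model E p L F v v = F v"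
  using tensor_model_error[OF assms assms(4)] assms(1) by (simp add: power_0_left)

text \<open>
  The objective of the dual step is quadratic with Hessian \<open>-I\<close>. At the maximiser \<open>v\<close> its slope \<open>c\<close>
  towards any other point \<open>z\<close> of the convex set is at most \<open>0\<close>, so the exact second-order expansion
  at \<open>v\<close> yields the decrease \<open>1/2 \<parallel>z - v\<parallel>\<^sup>2\<close>.
\<close>

lemma dual_step_strong:
  fixes s :: "'a::real_inner"
  assumes step: "dual_step X x0 s v" and X: "convex X" and z: "z \<in> X"
  shows "v \<in> X" "s \<bullet> (z - v) \<le> (norm (z - x0))\<^sup>2 / 2 - (norm (v - x0))\<^sup>2 / 2 - (norm (z - v))\<^sup>2 / 2"
proof -
  let ?\<phi> = "\<lambda>v. s \<bullet> (v - x0) - 1/2 * (norm (v - x0))\<^sup>2"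
  have max: "v \<in> X" "\<And>x. x \<in> X \<Longrightarrow> ?\<phi> x \<le> ?\<phi> v"
    using step unfolding dual_step_def is_arg_max_def by (auto simp: not_less)
  show "v \<in> X" by (rule max)
  define c where "c = s \<bullet> (z - v) - (v - x0) \<bullet> (z - v)"
  have expand: "?\<phi> (v + t *\<^sub>R (z - v)) = ?\<phi> v + t * c - t\<^sup>2 / 2 * (norm (z - v))\<^sup>2" for t
  proof -
    have "s \<bullet> (a + t *\<^sub>R b) - 1/2 * (norm (a + t *\<^sub>R b))\<^sup>2
      = s \<bullet> a - 1/2 * (norm a)\<^sup>2 + t * (s \<bullet> b - a \<bullet> b) - t\<^sup>2 / 2 * (norm b)\<^sup>2" for a b
      unfolding power2_norm_eq_inner
      by (simp add: inner_add_left inner_add_right inner_commute[of b a] power2_eq_square field_simps)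
    from this[of "v - x0" "z - v"] show ?thesis
      unfolding c_def by (simp add: algebra_simps)
  qed
  have small: "c \<le> t / 2 * (norm (z - v))\<^sup>2" if t: "0 < t" "t \<le> 1" for t
  proof -
    have "(1 - t) *\<^sub>R v + t *\<^sub>R z \<in> X"
      using X max(1) z t by (intro convexD) auto
    moreover have "(1 - t) *\<^sub>R v + t *\<^sub>R z = v + t *\<^sub>R (z - v)" by (simp add: algebra_simps)
    ultimately have "t * c \<le> t * (t / 2 * (norm (z - v))\<^sup>2)"
      using max(2)[of "v + t *\<^sub>R (z - v)"] expand[of t] by (simp add: power2_eq_square)
    then show ?thesis using t(1) by simp
  qed
  have "c \<le> 0"
  proof (rule tendsto_lowerbound)
    show "((\<lambda>t. t / 2 * (norm (z - v))\<^sup>2) \<longlongrightarrow> 0) (at_right 0)"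
      by (auto intro!: tendsto_eq_intros)
    show "\<forall>\<^sub>F t in at_right 0. c \<le> t / 2 * (norm (z - v))\<^sup>2"
      unfolding eventually_at_right_field using small by (intro exI[of _ 1]) auto
  qed simp
  moreover have "?\<phi> z = ?\<phi> v + c - (norm (z - v))\<^sup>2 / 2" using expand[of 1] by simp
  moreover have "s \<bullet> (z - x0) - s \<bullet> (v - x0) = s \<bullet> (z - v)" by (simp add: inner_diff_right)
  ultimately show "s \<bullet> (z - v) \<le> (norm (z - x0))\<^sup>2 / 2 - (norm (v - x0))\<^sup>2 / 2 - (norm (z - v))\<^sup>2 / 2"
    by simp
qed

text \<open>
  With \<open>r = \<parallel>y - v\<parallel>\<close>, \<open>t = \<parallel>z - v\<parallel>\<close> and \<open>a = w L r\<^sup>p\<^sup>-\<^sup>1 / p!\<close>, the Taylor error costs \<open>a r (r + t)\<close>, the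
  inexact solution of the subproblem costs \<open>a r\<^sup>2\<close>, and the regularisation term gains
  \<open>5 p a (r\<^sup>2 - r t)\<close>. The two bounds on an admissible weight say exactly that \<open>(5 p + 1) a \<le> 1/2\<close> and
  \<open>(5 p - 2) a \<ge> 1/4\<close>; what is left is \<open>r t / 2 - r\<^sup>2 / 4 - t\<^sup>2 / 2 \<le> - r\<^sup>2 / 8\<close>.
\<close>

lemma iteration_decrease:
  fixes F :: "'a::real_inner \<Rightarrow> 'a"
  assumes p: "p \<ge> 1" and E: "subspace E" "order_smooth (p - 1) L E F"
    and X: "X \<subseteq> E" "bounded X" and v: "v \<in> X" and z: "z \<in> X" and L: "L > 0"
    and y: "subproblem_solution E p L F X v y" and w: "admissible_weight p L v y w"
  shows "w * (F y \<bullet> (y - z)) - (norm (z - v))\<^sup>2 / 2 \<le> - (norm (y - v))\<^sup>2 / 8"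
proof -
  define r t where "r = norm (y - v)" and "t = norm (z - v)"
  define a where "a = w * L * r ^ (p - 1) / fact p"
  have yX: "y \<in> X" using y by (simp add: subproblem_solution_def)
  have nn: "r \<ge> 0" "t \<ge> 0" by (simp_all add: r_def t_def)
  have a: "w > 0" "1 / (20 * real p - 8) \<le> a" "a \<le> 1 / (10 * real p + 2)"
    using w by (simp_all add: admissible_weight_def a_def r_def)
  define e where "e = F y + (5 * L / fact (p - 1) * r ^ (p - 1)) *\<^sub>R (y - v) - tensor_model E p L F v y"
  have e: "norm e \<le> L / fact p * r ^ p"
    unfolding e_def r_def using tensor_model_error[OF p E] v yX X by blast
  have fp: "fact p = real p * fact (p - 1)" using p by (simp add: fact_reduce)
  have p1: "real p \<ge> 1" using p by simp
  have rp: "r ^ p = r * r ^ (p - 1)" using p by (cases p) auto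
  have "norm (y - z) \<le> r + t"
    unfolding r_def t_def using norm_triangle_ineq4[of "y - v" "z - v"] by simp
  then have "e \<bullet> (y - z) \<le> (L / fact p * r ^ p) * (r + t)"
    by (intro order.trans[OF norm_cauchy_schwarz] mult_mono e) (use nn L in auto)
  then have 1: "w * (e \<bullet> (y - z)) \<le> a * (r * (r + t))"
    using mult_left_mono[OF _ less_imp_le[OF a(1)]] by (fastforce simp: a_def rp mult_ac)
  have "w * (tensor_model E p L F v y \<bullet> (y - z)) \<le> w * (L / fact p * r ^ (p + 1))"
    unfolding r_def using a(1) by (intro mult_left_mono subproblem_solutionD[OF y X(2) z]) auto
  also have "\<dots> = a * r\<^sup>2" by (simp add: a_def rp power2_eq_square)
  finally have 2: "w * (tensor_model E p L F v y \<bullet> (y - z)) \<le> a * r\<^sup>2" .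
  have "(y - v) \<bullet> (y - z) = r\<^sup>2 - (y - v) \<bullet> (z - v)"
    unfolding r_def power2_norm_eq_inner by (simp add: algebra_simps)
  then have "r\<^sup>2 - r * t \<le> (y - v) \<bullet> (y - z)"
    using norm_cauchy_schwarz[of "y - v" "z - v"] by (simp add: r_def t_def)
  then have 3: "5 * p * a * (r\<^sup>2 - r * t) \<le> 5 * p * a * ((y - v) \<bullet> (y - z))"
    using a L nn by (intro mult_left_mono) (auto simp: a_def)
  have "w * (F y \<bullet> (y - z)) = w * (e \<bullet> (y - z)) + w * (tensor_model E p L F v y \<bullet> (y - z))
      - w * (5 * L / fact (p - 1) * r ^ (p - 1) * ((y - v) \<bullet> (y - z)))"
    unfolding e_def inner_diff_left[of _ _ "y - z"] inner_add_left[of _ _ "y - z"]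
      inner_scaleR_left[of _ _ "y - z"] by algebra
  also have "w * (5 * L / fact (p - 1) * r ^ (p - 1) * ((y - v) \<bullet> (y - z)))
      = 5 * p * a * ((y - v) \<bullet> (y - z))"
    using p1 by (simp add: a_def fp)
  finally have "w * (F y \<bullet> (y - z)) \<le> a * (r * (r + t)) + a * r\<^sup>2 - 5 * p * a * (r\<^sup>2 - r * t)"
    using 1 2 3 by linarith
  also have "\<dots> = (5 * real p + 1) * a * (r * t) - (5 * real p - 2) * a * r\<^sup>2"
    by (simp add: algebra_simps power2_eq_square)
  also have "\<dots> \<le> 1 / 2 * (r * t) - 1 / 4 * r\<^sup>2"
  proof (intro diff_mono mult_right_mono)
    show "(5 * real p + 1) * a \<le> 1 / 2" using a(3) p1 by (simp add: field_simps)
    show "1 / 4 \<le> (5 * real p - 2) * a" using a(2) p1 by (simp add: field_simps)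
  qed (use nn in auto)
  finally have "w * (F y \<bullet> (y - z)) \<le> 1 / 2 * (r * t) - 1 / 4 * r\<^sup>2" .
  moreover have "0 \<le> (t - r / 2)\<^sup>2" by simp \<comment> \<open>the square completed in \<open>t\<close>\<close>
  ultimately show ?thesis
    unfolding r_def[symmetric] t_def[symmetric] by (simp add: power2_eq_square algebra_simps)
qed

text \<open>
  The left-hand side is the tangent at \<open>u = 1\<close> of the convex function \<open>u \<mapsto> u powr (-n/2)\<close>, with
  \<open>u = x\<^sup>2\<close>. Convexity is obtained from Bernoulli's inequality for \<open>1/x\<close> and the case \<open>n = 1\<close>.
\<close>

lemma inverse_power_tangent:
  fixes x :: real
  assumes "x > 0"
  shows "1 - real n / 2 * (x\<^sup>2 - 1) \<le> 1 / x ^ n"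
proof -
  \<comment> \<open>The polynomial \<open>x\<^sup>3 - 3 x + 2\<close> has the double root \<open>1\<close>.\<close>
  have "0 \<le> (x - 1)\<^sup>2 * (x + 2) / (2 * x)" using assms by simp
  also have "\<dots> = (1 / x - 1) + (x\<^sup>2 - 1) / 2"
    using assms by (simp add: field_simps power2_eq_square)
  finally have "real n * - ((x\<^sup>2 - 1) / 2) \<le> real n * (1 / x - 1)"
    by (intro mult_left_mono) auto
  also have "1 + real n * (1 / x - 1) \<le> (1 + (1 / x - 1)) ^ n"
    using assms by (intro Bernoulli_inequality) simp
  ultimately show ?thesis by (simp add: power_one_over)
qed

text \<open>
  The bound \<open>w \<ge> c / r\<^sup>p\<^sup>-\<^sup>1\<close> from the definition, with \<open>r = \<parallel>y - v\<parallel>\<close>, is replaced by the tangent at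
  a radius \<open>\<rho>\<close> in the variable \<open>r\<^sup>2\<close>. The result is affine in \<open>r\<^sup>2\<close> and can hence be summed over a run
  of which only \<open>\<Sum> r\<^sup>2\<close> is controlled.
\<close>

lemma admissible_weight_lower:
  fixes v y :: "'a::real_inner"
  assumes p: "p \<ge> 1" and L: "L > 0" and w: "admissible_weight p L v y w"
    and ne: "\<not> (p \<ge> 2 \<and> y = v)" and \<rho>: "\<rho> > 0"
  shows "fact p / ((20 * real p - 8) * L * \<rho> ^ (p - 1))
      * (1 - real (p - 1) / 2 * ((norm (y - v))\<^sup>2 / \<rho>\<^sup>2 - 1)) \<le> w"
proof -
  define r where "r = norm (y - v)"
  define c where "c = fact p / ((20 * real p - 8) * L * \<rho> ^ (p - 1))"
  have p1: "real p \<ge> 1" using p by simp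
  have c: "c > 0" unfolding c_def using p1 L \<rho> by simp
  have w': "1 / (20 * real p - 8) \<le> w * L * r ^ (p - 1) / fact p"
    using w by (simp add: admissible_weight_def r_def)
  \<comment> \<open>For \<open>p = 1\<close> the case \<open>r = 0\<close> does occur, and then \<open>r ^ 0 = 1\<close>.\<close>
  have rpos: "r ^ (p - 1) > 0"
    using ne p by (cases "p = 1") (auto simp: r_def)
  have low: "1 - real (p - 1) / 2 * (r\<^sup>2 / \<rho>\<^sup>2 - 1) \<le> 1 / (r / \<rho>) ^ (p - 1)"
  proof (cases "p = 1")
    case False
    then have "r > 0" using ne p by (simp add: r_def)
    then show ?thesis using inverse_power_tangent[of "r / \<rho>" "p - 1"] \<rho> by (simp add: power_divide)
  qed simp
  have "c * (1 - real (p - 1) / 2 * (r\<^sup>2 / \<rho>\<^sup>2 - 1)) \<le> c * (1 / (r / \<rho>) ^ (p - 1))"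
    using low c by (intro mult_left_mono) auto
  also have "\<dots> = fact p / ((20 * real p - 8) * L * r ^ (p - 1))"
    using \<rho> by (simp add: c_def power_divide)
  also have "\<dots> \<le> w"
  proof -
    have "fact p \<le> w * L * r ^ (p - 1) * (20 * real p - 8)"
      using w' p1 by (simp add: divide_simps)
    moreover have "0 < (20 * real p - 8) * L * r ^ (p - 1)" using p1 L rpos by simp
    ultimately show ?thesis by (simp add: pos_divide_le_eq mult_ac)
  qed
  finally show ?thesis by (simp add: c_def r_def)
qed

section \<open>Regret and total weight of a run\<close>

lemma perseus_run_count: "perseus_run E p L F X x0 k n ws x s \<Longrightarrow> n = k \<and> length ws = k"
  by (induction rule: perseus_run.induct) auto

lemma perseus_run_weights:
  "perseus_run E p L F X x0 k n ws x s \<Longrightarrow> (w, y) \<in> set ws \<Longrightarrow> 0 < w \<and> y \<in> X"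
  by (induction rule: perseus_run.induct) (auto simp: admissible_weight_def subproblem_solution_def)

lemma perseus_run_dual:
  "perseus_run E p L F X x0 k n ws x s \<Longrightarrow> s = - (\<Sum>(w, y)\<leftarrow>ws. w *\<^sub>R F y)"
  by (induction rule: perseus_run.induct) auto

lemma weighted_regret_shift:
  fixes F :: "'a::real_inner \<Rightarrow> 'a"
  shows "(\<Sum>(w, y)\<leftarrow>ws. w * (F y \<bullet> (y - z))) =
    (\<Sum>(w, y)\<leftarrow>ws. w * (F y \<bullet> (y - v))) - (\<Sum>(w, y)\<leftarrow>ws. w *\<^sub>R F y) \<bullet> (z - v)"
  by (induction ws) (auto simp: algebra_simps inner_diff_right inner_add_left)

text \<open>
  \<open>Q\<close> is the sum of the squared step lengths \<open>\<parallel>x\<^sub>i - v\<^sub>i\<parallel>\<^sup>2\<close>, which the list of weights and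
  iterates does not record. Both statements are about the same \<open>Q\<close>: a large \<open>Q\<close> improves the regret, a
  small one makes the weights large. The first is quantified over all \<open>z\<close> because the induction
  step applies the hypothesis to the current dual point \<open>v\<close>; the radius \<open>\<rho>\<close> of the second is chosen
  later, in terms of the total number of iterations.
\<close>

lemma perseus_run_potential:
  fixes F :: "'a::real_inner \<Rightarrow> 'a"
  assumes "perseus_run E p L F X x0 k n ws x s"
    and p: "p \<ge> 1" and E: "subspace E" "order_smooth (p - 1) L E F"
    and X: "X \<subseteq> E" "bounded X" "convex X" "x0 \<in> X" and L: "L > 0"
  shows "\<exists>Q\<ge>0. (\<forall>z\<in>X. (\<Sum>(w, y)\<leftarrow>ws. w * (F y \<bullet> (y - z))) + Q / 8 \<le> (norm (z - x0))\<^sup>2 / 2) \<and>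
    (\<forall>\<rho>>0. fact p / ((20 * real p - 8) * L * \<rho> ^ (p - 1))
        * (real k - real (p - 1) / 2 * (Q / \<rho>\<^sup>2 - real k)) \<le> (\<Sum>(w, y)\<leftarrow>ws. w))"
  using assms(1)
proof (induction rule: perseus_run.induct)
  case start
  show ?case by (intro exI[of _ 0]) simp
next
  case (iteration k n ws x s v y w)
  from iteration.IH obtain Q where Q0: "Q \<ge> 0" and
    Q: "\<And>z. z \<in> X \<Longrightarrow> (\<Sum>(w, y)\<leftarrow>ws. w * (F y \<bullet> (y - z))) + Q / 8 \<le> (norm (z - x0))\<^sup>2 / 2"
    and W: "\<And>\<rho>. \<rho> > 0 \<Longrightarrow> fact p / ((20 * real p - 8) * L * \<rho> ^ (p - 1))
        * (real k - real (p - 1) / 2 * (Q / \<rho>\<^sup>2 - real k)) \<le> (\<Sum>(w, y)\<leftarrow>ws. w)"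
    by blast
  define r where "r = norm (y - v)"
  have v: "v \<in> X" using dual_step_strong(1)[OF iteration.hyps(3) X(3) X(4)] .
  have s: "s = - (\<Sum>(w, y)\<leftarrow>ws. w *\<^sub>R F y)"
    using perseus_run_dual[OF iteration.hyps(1)] .
  show ?case
  proof (intro exI[of _ "Q + r\<^sup>2"] conjI ballI allI impI)
    show "0 \<le> Q + r\<^sup>2" using Q0 by simp
  next
    fix z assume z: "z \<in> X"
    have "(\<Sum>(w, y)\<leftarrow>ws. w * (F y \<bullet> (y - z))) =
        (\<Sum>(w, y)\<leftarrow>ws. w * (F y \<bullet> (y - v))) + s \<bullet> (z - v)"
      unfolding s by (subst weighted_regret_shift[where v = v]) simp
    then show "(\<Sum>(w, y)\<leftarrow>ws @ [(w, y)]. w * (F y \<bullet> (y - z))) + (Q + r\<^sup>2) / 8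
        \<le> (norm (z - x0))\<^sup>2 / 2"
      using Q[OF v] dual_step_strong(2)[OF iteration.hyps(3) X(3) z]
        iteration_decrease[OF p E X(1,2) v z L iteration.hyps(4,6)]
      by (simp add: r_def add_divide_distrib)
  next
    fix \<rho> :: real assume \<rho>: "\<rho> > 0"
    let ?c = "fact p / ((20 * real p - 8) * L * \<rho> ^ (p - 1))"
    have "?c * (real (Suc k) - real (p - 1) / 2 * ((Q + r\<^sup>2) / \<rho>\<^sup>2 - real (Suc k)))
      = ?c * ((real k - real (p - 1) / 2 * (Q / \<rho>\<^sup>2 - real k))
          + (1 - real (p - 1) / 2 * (r\<^sup>2 / \<rho>\<^sup>2 - 1)))"
      by (rule arg_cong[where f = "\<lambda>u. ?c * u"]) (simp add: add_divide_distrib algebra_simps)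
    then show "?c * (real (Suc k) - real (p - 1) / 2 * ((Q + r\<^sup>2) / \<rho>\<^sup>2 - real (Suc k)))
      \<le> (\<Sum>(w, y)\<leftarrow>ws @ [(w, y)]. w)"
      using W[OF \<rho>] admissible_weight_lower[OF p L iteration.hyps(6,5) \<rho>]
      by (simp add: r_def distrib_left)
  qed
qed

section \<open>The gap of the returned point\<close>

lemma gap_vi_solution:
  fixes F :: "'a::real_inner \<Rightarrow> 'a"
  assumes F: "monotone_operator_on E F" and X: "X \<subseteq> E" and z: "vi_solution F X z"
  shows "gap F X z \<le> 0"
  unfolding gap_def
proof (rule cSUP_least)
  show "X \<noteq> {}" using z by (auto simp: vi_solution_def)
  fix x assume x: "x \<in> X"
  have "F z \<bullet> (x - z) \<ge> 0" "z \<in> X" using z x by (auto simp: vi_solution_def)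
  moreover have "(F x - F z) \<bullet> (x - z) \<ge> 0"
    using F x X \<open>z \<in> X\<close> by (auto simp: monotone_operator_on_def)
  ultimately show "F x \<bullet> (z - x) \<le> 0" by (simp add: inner_diff_left inner_diff_right)
qed

lemma average_inner:
  fixes g x :: "'a::real_inner"
  assumes "(\<Sum>(w, y)\<leftarrow>ws. w) \<noteq> 0"
  shows "g \<bullet> ((1 / (\<Sum>(w, y)\<leftarrow>ws. w)) *\<^sub>R (\<Sum>(w, y)\<leftarrow>ws. w *\<^sub>R y) - x)
    = (\<Sum>(w, y)\<leftarrow>ws. w * (g \<bullet> (y - x))) / (\<Sum>(w, y)\<leftarrow>ws. w)"
proof -
  have "(\<Sum>(w, y)\<leftarrow>ws. w * (g \<bullet> (y - x)))
    = g \<bullet> (\<Sum>(w, y)\<leftarrow>ws. w *\<^sub>R y) - (\<Sum>(w, y)\<leftarrow>ws. w) * (g \<bullet> x)"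
    by (induction ws) (auto simp: algebra_simps inner_diff_right inner_add_right)
  then show ?thesis using assms by (simp add: inner_diff_right field_simps)
qed

text \<open>
  The regret bound is applied to each \<open>z\<close> separately. Where the regret \<open>S\<close> is positive, the bound
  itself limits \<open>Q\<close> by \<open>4 D\<^sup>2\<close>, which makes the total weight large.
\<close>

lemma gap_average:
  fixes F :: "'a::real_inner \<Rightarrow> 'a"
  assumes run: "perseus_run E p L F X x0 T n ws x s" and T: "T \<ge> 1"
    and p: "p \<ge> 1" and E: "subspace E" "order_smooth (p - 1) L E F"
    and F: "monotone_operator_on E F"
    and X: "X \<subseteq> E" "bounded X" "convex X" "x0 \<in> X" and L: "L > 0"
    and D: "diameter X = D" "D > 0"
  shows "gap F X ((1 / (\<Sum>(w, y)\<leftarrow>ws. w)) *\<^sub>R (\<Sum>(w, y)\<leftarrow>ws. w *\<^sub>R y))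
    \<le> 2 ^ p * (5 * real p - 2) / fact p * (L * D ^ (p + 1)) / sqrt (real T) ^ (p + 1)"
    (is "_ \<le> ?B")
  unfolding gap_def
proof (rule cSUP_least)
  show "X \<noteq> {}" using X by auto
  fix z assume z: "z \<in> X"
  define \<Lambda> where "\<Lambda> = (\<Sum>(w, y)\<leftarrow>ws. w)"
  have ws: "0 < w" "y \<in> X" if "(w, y) \<in> set ws" for w y
    using perseus_run_weights[OF run that] by auto
  have p1: "real p \<ge> 1" using p by simp
  have "ws \<noteq> []" using perseus_run_count[OF run] T by auto
  then have \<Lambda>: "\<Lambda> > 0"
    unfolding \<Lambda>_def using ws(1)
  proof (induction ws rule: list_nonempty_induct)
    case (cons a ws)
    then show ?case by (cases a) (fastforce intro: add_pos_pos)
  qed auto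
  define S where "S = (\<Sum>(w, y)\<leftarrow>ws. w * (F y \<bullet> (y - z)))"
  have "(\<Sum>(w, y)\<leftarrow>ws. w * (F z \<bullet> (y - z))) \<le> S"
    unfolding S_def
  proof (rule sum_list_mono, clarify)
    fix w y assume wy: "(w, y) \<in> set ws"
    have "(F y - F z) \<bullet> (y - z) \<ge> 0"
      using F X(1) z ws(2)[OF wy] by (auto simp: monotone_operator_on_def)
    then show "w * (F z \<bullet> (y - z)) \<le> w * (F y \<bullet> (y - z))"
      using ws(1)[OF wy] by (intro mult_left_mono) (auto simp: inner_diff_left)
  qed
  then have gap_S: "F z \<bullet> ((1 / \<Lambda>) *\<^sub>R (\<Sum>(w, y)\<leftarrow>ws. w *\<^sub>R y) - z) \<le> S / \<Lambda>"
    unfolding \<Lambda>_def using \<Lambda> by (subst average_inner) (auto simp: \<Lambda>_def divide_right_mono)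
  have "S / \<Lambda> \<le> ?B"
  proof (cases "S \<le> 0")
    case True
    then have "S / \<Lambda> \<le> 0" using \<Lambda> by (simp add: divide_nonpos_pos)
    also have "0 \<le> ?B" using p1 L D by simp
    finally show ?thesis .
  next
    case False
    obtain Q where Q0: "Q \<ge> 0" and Q: "S + Q / 8 \<le> (norm (z - x0))\<^sup>2 / 2"
      and W: "\<And>\<rho>. \<rho> > 0 \<Longrightarrow> fact p / ((20 * real p - 8) * L * \<rho> ^ (p - 1))
        * (real T - real (p - 1) / 2 * (Q / \<rho>\<^sup>2 - real T)) \<le> \<Lambda>"
      using perseus_run_potential[OF run p E X L] z unfolding S_def \<Lambda>_def by blast
    have "norm (z - x0) \<le> D"
      using diameter_bounded_bound[OF X(2) z X(4)] D by (simp add: dist_norm)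
    then have nD: "(norm (z - x0))\<^sup>2 \<le> D\<^sup>2" by (intro power_mono) auto
    \<comment> \<open>the common step length for which \<open>Q\<close> would be \<open>4 D\<^sup>2\<close>; it makes the tangent bound optimal\<close>
    define \<rho> where "\<rho> = 2 * D / sqrt (real T)"
    have sT: "sqrt (real T) > 0" using T by simp
    then have \<rho>: "\<rho> > 0" using D by (simp add: \<rho>_def)
    have "\<rho>\<^sup>2 * real T = 4 * D\<^sup>2"
      using T by (simp add: \<rho>_def power_divide power_mult_distrib)
    then have QT: "Q / \<rho>\<^sup>2 - real T \<le> 0"
      using Q nD False \<rho> by (simp add: divide_le_eq mult.commute)
    define c where "c = fact p / ((20 * real p - 8) * L * \<rho> ^ (p - 1))"
    have c: "c > 0" using p1 L \<rho> by (simp add: c_def)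
    have "c * real T \<le> c * (real T - real (p - 1) / 2 * (Q / \<rho>\<^sup>2 - real T))"
      using c QT by (intro mult_left_mono) (auto simp: mult_nonneg_nonpos)
    also have "\<dots> \<le> \<Lambda>" unfolding c_def by (rule W[OF \<rho>])
    finally have low: "c * real T \<le> \<Lambda>" .
    have cT: "c * real T > 0" using c T by simp
    obtain m where m: "p = Suc m" using p by (cases p) auto
    have "S \<le> D\<^sup>2 / 2" using Q Q0 nD by simp
    then have "S / \<Lambda> \<le> (D\<^sup>2 / 2) / (c * real T)"
      using low cT by (intro frac_le) auto
    also have "real T = (sqrt (real T))\<^sup>2" by simp
    also have "(D\<^sup>2 / 2) / (c * (sqrt (real T))\<^sup>2) = ?B"
    proof -
      have "(D\<^sup>2 / 2) / (f / ((20 * real p - 8) * L * (2 * D / u) ^ m) * u\<^sup>2)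
        = 2 ^ Suc m * (5 * real p - 2) / f * (L * D ^ (Suc m + 1)) / u ^ (Suc m + 1)"
        if "u > 0" "f > 0" for f u :: real
        using that L D p1 by (simp add: field_simps power_mult_distrib power2_eq_square)
      from this[OF sT, of "fact p"] show ?thesis
        by (simp add: c_def \<rho>_def m)
    qed
    finally show ?thesis .
  qed
  then show "F z \<bullet> ((1 / (\<Sum>(w, y)\<leftarrow>ws. w)) *\<^sub>R (\<Sum>(w, y)\<leftarrow>ws. w *\<^sub>R y) - z) \<le> ?B"
    using gap_S by (simp add: \<Lambda>_def)
qed

lemma perseus_output_correct:
  fixes F :: "'a::real_inner \<Rightarrow> 'a"
  assumes out: "perseus_output E p L F X x0 T early xhat n"
    and p: "p \<ge> 1" and E: "subspace E" "order_smooth (p - 1) L E F"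
    and F: "monotone_operator_on E F"
    and X: "X \<subseteq> E" "bounded X" "convex X" "x0 \<in> X" and L: "L > 0"
    and D: "diameter X = D" "D > 0" and T: "T \<ge> 1"
  shows "if early then gap F X xhat \<le> 0 \<and> vi_solution F X xhat \<and> n \<le> T
    else gap F X xhat \<le> 2 ^ p * (5 * real p - 2) / fact p * (L * D ^ (p + 1)) / sqrt (real T) ^ (p + 1)
      \<and> n = T"
  using out
proof cases
  case (stop_at_iterate k ws s)
  then show ?thesis
    using gap_vi_solution[OF F X(1)] perseus_run_count by fastforce
next
  case (stop_after_subproblem k n' ws x s v)
  have v: "v \<in> X" using dual_step_strong(1)[OF stop_after_subproblem(6) X(3,4)] .
  have "F v \<bullet> (v - z) \<le> 0" if "z \<in> X" for z
    using subproblem_solutionD[OF stop_after_subproblem(7) X(2) that]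
      tensor_model_at_center[OF p E] v X(1) stop_after_subproblem(9) by auto
  then have "vi_solution F X xhat"
    using v stop_after_subproblem(9) by (auto simp: vi_solution_def inner_diff_right)
  then show ?thesis
    using gap_vi_solution[OF F X(1)] perseus_run_count[OF stop_after_subproblem(3)]
      stop_after_subproblem by auto
next
  case (average ws x s)
  then show ?thesis
    using gap_average[OF _ T p E F X L D] perseus_run_count by fastforce
qed

theorem theorem3p1:
  fixes p :: nat
  assumes "p \<ge> 1"
  shows "\<exists>C>0. \<forall>L>0. \<forall>D>0. \<forall>\<epsilon>. 0 < \<epsilon> \<and> \<epsilon> < 1 \<longrightarrow>
    (\<exists>T::nat. T \<ge> 1 \<and>
       real T \<le> C * max 1 ((L * D ^ (p + 1) / \<epsilon>) powr (2 / (real p + 1))) \<and>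
       (\<forall>(d::nat) (X::fseq set) (F::fseq \<Rightarrow> fseq) x0.
          X \<subseteq> Rn d \<and> closed X \<and> convex X \<and> bounded X \<and> diameter X = D \<and>
          F \<in> Rn d \<rightarrow> Rn d \<and> order_smooth (p - 1) L (Rn d) F \<and>
          monotone_operator_on (Rn d) F \<and> x0 \<in> X \<longrightarrow>
          (\<forall>early xhat n. perseus_output (Rn d) p L F X x0 T early xhat n \<longrightarrow>
             gap F X xhat \<le> \<epsilon> \<and>
             (if early then vi_solution F X xhat \<and> n \<le> T else n = T))))"
proof -
  define q where "q = 2 / (real p + 1)"
  define K where "K = 2 ^ p * (5 * real p - 2) / fact p"
  have q: "q > 0" by (simp add: q_def)
  have K: "K > 0" using assms by (simp add: K_def)
  show ?thesis
    unfolding q_def[symmetric]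
  proof (rule exI[of _ "2 * max 1 (K powr q)"], intro conjI allI impI)
    show "0 < 2 * max 1 (K powr q)" by simp
  next
    fix L D \<epsilon> :: real assume L: "0 < L" and D: "0 < D" and "0 < \<epsilon> \<and> \<epsilon> < 1"
    then have \<epsilon>: "\<epsilon> > 0" by simp
    define b where "b = L * D ^ (p + 1) / \<epsilon>"
    have b: "b > 0" using L D \<epsilon> by (simp add: b_def)
    \<comment> \<open>the smallest positive \<open>T\<close> with \<open>K b \<le> T powr ((p + 1) / 2)\<close>; rounding up costs the factor 2 of \<open>C\<close>\<close>
    define T where "T = nat \<lceil>max 1 ((K * b) powr q)\<rceil>"
    have T_ge: "real T \<ge> max 1 ((K * b) powr q)"
      unfolding T_def by (rule real_nat_ceiling_ge)
    then have T1: "T \<ge> 1" by simp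
    have "(K * b) powr q = K powr q * b powr q"
      using K b by (simp add: powr_mult)
    also have "\<dots> \<le> max 1 (K powr q) * max 1 (b powr q)"
      by (intro mult_mono) auto
    finally have "max 1 ((K * b) powr q) \<le> max 1 (K powr q) * max 1 (b powr q)"
      using mult_mono[of 1 "max 1 (K powr q)" 1 "max 1 (b powr q)"] by simp
    then have "2 * max 1 ((K * b) powr q) \<le> 2 * (max 1 (K powr q) * max 1 (b powr q))"
      by (intro mult_left_mono) auto
    moreover have "real T \<le> 2 * max 1 ((K * b) powr q)"
      unfolding T_def by linarith
    ultimately have T_le: "real T \<le> 2 * max 1 (K powr q) * max 1 (b powr q)"
      unfolding mult.assoc by (rule order.trans[rotated])
    have "q * (real (p + 1) / 2) = 1"
      by (simp add: q_def field_simps)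
    then have "K * b = ((K * b) powr q) powr (real (p + 1) / 2)"
      using K b by (simp only: powr_powr) simp
    also have "\<dots> \<le> real T powr (real (p + 1) / 2)"
      using T_ge by (intro powr_mono2) auto
    also have "\<dots> = (real T powr (1 / 2)) powr real (p + 1)"
      by (simp add: powr_powr)
    also have "\<dots> = sqrt (real T) ^ (p + 1)"
      using T1 by (subst powr_realpow) (auto simp: powr_half_sqrt)
    finally have "K * b \<le> sqrt (real T) ^ (p + 1)" .
    moreover have "sqrt (real T) ^ (p + 1) > 0" using T1 by simp
    ultimately have small: "K * (L * D ^ (p + 1)) / sqrt (real T) ^ (p + 1) \<le> \<epsilon>"
      using \<epsilon> by (simp add: b_def divide_simps mult.commute del: power_Suc)
    show "\<exists>T::nat. T \<ge> 1 \<and>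
       real T \<le> 2 * max 1 (K powr q) * max 1 ((L * D ^ (p + 1) / \<epsilon>) powr q) \<and>
       (\<forall>(d::nat) (X::fseq set) (F::fseq \<Rightarrow> fseq) x0.
          X \<subseteq> Rn d \<and> closed X \<and> convex X \<and> bounded X \<and> diameter X = D \<and>
          F \<in> Rn d \<rightarrow> Rn d \<and> order_smooth (p - 1) L (Rn d) F \<and>
          monotone_operator_on (Rn d) F \<and> x0 \<in> X \<longrightarrow>
          (\<forall>early xhat n. perseus_output (Rn d) p L F X x0 T early xhat n \<longrightarrow>
             gap F X xhat \<le> \<epsilon> \<and>
             (if early then vi_solution F X xhat \<and> n \<le> T else n = T)))"
    proof (intro exI[of _ T] conjI allI impI)
      show "T \<ge> 1" by (rule T1)
      show "real T \<le> 2 * max 1 (K powr q) * max 1 ((L * D ^ (p + 1) / \<epsilon>) powr q)"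
        using T_le by (simp add: b_def)
    next
      fix d X and F :: "fseq \<Rightarrow> fseq" and x0 early xhat n
      assume "X \<subseteq> Rn d \<and> closed X \<and> convex X \<and> bounded X \<and> diameter X = D \<and>
          F \<in> Rn d \<rightarrow> Rn d \<and> order_smooth (p - 1) L (Rn d) F \<and>
          monotone_operator_on (Rn d) F \<and> x0 \<in> X"
        and out: "perseus_output (Rn d) p L F X x0 T early xhat n"
      then have X: "X \<subseteq> Rn d" "bounded X" "convex X" "x0 \<in> X" "diameter X = D"
        and F: "order_smooth (p - 1) L (Rn d) F" "monotone_operator_on (Rn d) F"
        by auto
      show "gap F X xhat \<le> \<epsilon>"
        and "if early then vi_solution F X xhat \<and> n \<le> T else n = T"
        using perseus_output_correct[OF out assms subspace_Rn F X(1-4) L X(5) D T1]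
          small \<epsilon> by (auto simp: K_def split: if_splits)
    qed
  qed
qed

end
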